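(* Let $\widehat{x}$ be a weak efficient solution of problem $(P)$. Then: (i) If the weak Abadie data qualification (WADQ) holds at $\widehat{x}$, one has $0_{n}\in F_{\ast}(\widehat{x})+\overline{G_{\ast}(\widehat{x})}$. (ii) If, in addition, the closed cone constraint qualification (CCCQ) holds at $\widehat{x}$, then $(P)$ satisfies the weak KKT condition at $\widehat{x}$.
   Context: Setting: $p\geq 2$, $I:=\{1,\ldots,p\}$; $f_i:\mathbb{R}^n\to\mathbb{R}$ ($i\in I$) are finite-valued convex functions; $T$ is an infinite index set; for each $t\in T$, $g_t:\mathbb{R}^n\to\mathbb{R}\cup\{+\infty\}$ is a lower semicontinuous proper convex function. Problem $(P)$: minimize $f(x):=(f_1(x),\ldots,f_p(x))$ subject to $g_t(x)\le 0$, $t\in T$, with feasible set $S:=\{x\in\mathbb{R}^n\mid g_t(x)\le 0\ \forall t\in T\}$ assumed nonempty. $\widehat{x}\in S$ is a weak efficient solution of $(P)$ if there is no $x\in S$ with $f_i(x)<f_i(\widehat{x})$ for all $i\in I$. Notation: $\partial$ is the Fenchel–Moreau subdifferential; $\overline{M}$ is the closure; for nonempty $M\subseteq\mathbb{R}^n$, $M^{0}:=\{d\mid x'd\le 0\ \forall x\in M\}$ and $M^{-}:=\{d\mid x'd<0\ \forall x\in M\}$; $\operatorname{cone}(M)$ is the convex cone containing the origin generated by $M$; $C(S,\widehat{x}):=\{v\mid\exists t_r\downarrow0,\ \exists v_r\to v:\ \widehat{x}+t_rv_r\in S\ \forall r\in\mathbb{N}\}$. $T(\widehat{x}):=\{t\in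 T\mid g_t(\widehat{x})=0\}$; $F(\widehat{x}):=\bigcup_{i=1}^p\partial f_i(\widehat{x})$, $F_\ast(\widehat{x}):=\operatorname{conv}(F(\widehat{x}))$; $G(\widehat{x}):=\bigcup_{t\in T(\widehat{x})}\partial g_t(\widehat{x})$, $G_\ast(\widehat{x}):=\operatorname{cone}(G(\widehat{x}))$; $F^{-}(\widehat{x})$ and $G^{0}(\widehat{x})$ are the corresponding polars of $F(\widehat{x})$ and $G(\widehat{x})$. WADQ holds at $\widehat{x}$ when $G(\widehat{x})\neq\emptyset$ and $F^{-}(\widehat{x})\cap G^{0}(\widehat{x})\subseteq C(S,\widehat{x})$. CCCQ holds at $\widehat{x}$ when $G_\ast(\widehat{x})$ is closed. The weak KKT condition holds at $\widehat{x}\in S$ when there exist $\alpha_i\ge0$ ($i\in I$) with $\sum_{i=1}^p\alpha_i=1$, and $\beta_t\ge0$ ($t\in T(\widehat{x})$), with $\beta_t\neq0$ for finitely many indices only, such that $0_n\in\sum_{i=1}^p\alpha_i\partial f_i(\widehat{x})+\sum_{t\in T(\widehat{x})}\beta_t\partial g_t(\widehat{x})$; equivalently, $0_n\in F_\ast(\widehat{x})+G_\ast(\widehat{x})$. *)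

theory Defs
  imports "HOL-Analysis.Analysis"
begin

text \<open>Functions with values in \<open>\<real> \<union> {+\<infinity>}\<close> are modelled as \<^typ>\<open>ereal\<close>-valued functions;
  the value \<open>-\<infinity>\<close> is excluded by properness.\<close>

definition proper_ereal :: "('a \<Rightarrow> ereal) \<Rightarrow> bool" where
  "proper_ereal h \<longleftrightarrow> (\<forall>x. h x \<noteq> -\<infinity>) \<and> (\<exists>x. h x \<noteq> \<infinity>)"

text \<open>Only meant for functions that avoid \<open>-\<infinity>\<close>. On \<^typ>\<open>ereal\<close>, \<open>0 * \<infinity> = 0\<close>, so the
  inequality holds trivially for the weights 0 and 1.\<close>

definition convex_ereal :: "('a::real_vector \<Rightarrow> ereal) \<Rightarrow> bool" where
  "convex_ereal h \<longleftrightarrow>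
     (\<forall>x y. \<forall>u\<ge>0. \<forall>v\<ge>0. u + v = 1 \<longrightarrow>
        h (u *\<^sub>R x + v *\<^sub>R y) \<le> ereal u * h x + ereal v * h y)"

definition lower_semicontinuous :: "('a::topological_space \<Rightarrow> ereal) \<Rightarrow> bool" where
  "lower_semicontinuous h \<longleftrightarrow> (\<forall>x. h x \<le> Liminf (at x) h)"

text \<open>The Fenchel--Moreau subdifferential, empty at points where the function is not finite.\<close>

definition subdifferential :: "('a::real_inner \<Rightarrow> ereal) \<Rightarrow> 'a \<Rightarrow> 'a set" where
  "subdifferential h x =
     {\<xi>. \<bar>h x\<bar> \<noteq> \<infinity> \<and> (\<forall>y. h x + ereal (\<xi> \<bullet> (y - x)) \<le> h y)}"

text \<open>The polars \<open>M\<^sup>0\<close> and \<open>M\<^sup>-\<close>.\<close>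

definition polar_cone :: "'a::real_inner set \<Rightarrow> 'a set" where
  "polar_cone M = {d. \<forall>x\<in>M. x \<bullet> d \<le> 0}"

definition strict_polar_cone :: "'a::real_inner set \<Rightarrow> 'a set" where
  "strict_polar_cone M = {d. \<forall>x\<in>M. x \<bullet> d < 0}"

text \<open>The contingent (Bouligand) cone. Passing to a subsequence, the step sizes may be
  taken decreasing, so \<open>t\<^sub>r \<down> 0\<close> is rendered as positivity and convergence to 0.\<close>

definition contingent_cone :: "'a::real_normed_vector set \<Rightarrow> 'a \<Rightarrow> 'a set" where
  "contingent_cone S x =
     {v. \<exists>(t :: nat \<Rightarrow> real) (w :: nat \<Rightarrow> 'a).
           (\<forall>r. 0 < t r) \<and> t \<longlonglongrightarrow> 0 \<and> w \<longlonglongrightarrow> v \<and> (\<forall>r. x + t r *\<^sub>R w r \<in> S)}"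

definition feasible_set :: "'t set \<Rightarrow> ('t \<Rightarrow> 'a \<Rightarrow> ereal) \<Rightarrow> 'a set" where
  "feasible_set T g = {x. \<forall>t\<in>T. g t x \<le> 0}"

definition weak_efficient ::
  "nat \<Rightarrow> (nat \<Rightarrow> 'a \<Rightarrow> real) \<Rightarrow> 't set \<Rightarrow> ('t \<Rightarrow> 'a \<Rightarrow> ereal) \<Rightarrow> 'a \<Rightarrow> bool" where
  "weak_efficient p f T g x \<longleftrightarrow>
     x \<in> feasible_set T g \<and>
     \<not> (\<exists>y\<in>feasible_set T g. \<forall>i\<in>{1..p}. f i y < f i x)"

definition active_set :: "'t set \<Rightarrow> ('t \<Rightarrow> 'a \<Rightarrow> ereal) \<Rightarrow> 'a \<Rightarrow> 't set" where
  "active_set T g x = {t\<in>T. g t x = 0}"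

definition F_subgrads ::
  "nat \<Rightarrow> (nat \<Rightarrow> 'a::real_inner \<Rightarrow> real) \<Rightarrow> 'a \<Rightarrow> 'a set" where
  "F_subgrads p f x = (\<Union>i\<in>{1..p}. subdifferential (\<lambda>y. ereal (f i y)) x)"

definition F_star ::
  "nat \<Rightarrow> (nat \<Rightarrow> 'a::real_inner \<Rightarrow> real) \<Rightarrow> 'a \<Rightarrow> 'a set" where
  "F_star p f x = convex hull (F_subgrads p f x)"

definition G_subgrads ::
  "'t set \<Rightarrow> ('t \<Rightarrow> 'a::real_inner \<Rightarrow> ereal) \<Rightarrow> 'a \<Rightarrow> 'a set" where
  "G_subgrads T g x = (\<Union>t\<in>active_set T g x. subdifferential (g t) x)"

text \<open>\<^const>\<open>convex_cone\<close> sets contain the origin; in particular the hull of the empty set is \<open>{0}\<close>.\<close>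

definition G_star ::
  "'t set \<Rightarrow> ('t \<Rightarrow> 'a::real_inner \<Rightarrow> ereal) \<Rightarrow> 'a \<Rightarrow> 'a set" where
  "G_star T g x = convex_cone hull (G_subgrads T g x)"

text \<open>\<open>WADQ\<close>: weak Abadie data qualification; \<open>CCCQ\<close>: closed cone constraint qualification.\<close>

definition WADQ ::
  "nat \<Rightarrow> (nat \<Rightarrow> 'a::real_inner \<Rightarrow> real) \<Rightarrow> 't set \<Rightarrow> ('t \<Rightarrow> 'a \<Rightarrow> ereal) \<Rightarrow> 'a \<Rightarrow> bool" where
  "WADQ p f T g x \<longleftrightarrow>
     G_subgrads T g x \<noteq> {} \<and>
     strict_polar_cone (F_subgrads p f x) \<inter> polar_cone (G_subgrads T g x)
       \<subseteq> contingent_cone (feasible_set T g) x"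

definition CCCQ :: "'t set \<Rightarrow> ('t \<Rightarrow> 'a::real_inner \<Rightarrow> ereal) \<Rightarrow> 'a \<Rightarrow> bool" where
  "CCCQ T g x \<longleftrightarrow> closed (G_star T g x)"

text \<open>The sums are Minkowski sums of sets. The sum over the active indices runs over the
  finite support of \<open>\<beta>\<close> only: an index with \<open>\<beta> t = 0\<close> contributes nothing, even if
  its subdifferential is empty. The empty sum is \<open>{0}\<close>.\<close>

definition weak_KKT ::
  "nat \<Rightarrow> (nat \<Rightarrow> 'a::real_inner \<Rightarrow> real) \<Rightarrow> 't set \<Rightarrow> ('t \<Rightarrow> 'a \<Rightarrow> ereal) \<Rightarrow> 'a \<Rightarrow> bool" where
  "weak_KKT p f T g x \<longleftrightarrow>
     (\<exists>(\<alpha> :: nat \<Rightarrow> real) (\<beta> :: 't \<Rightarrow> real).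
        (\<forall>i\<in>{1..p}. 0 \<le> \<alpha> i) \<and> (\<Sum>i\<in>{1..p}. \<alpha> i) = 1 \<and>
        (\<forall>t\<in>active_set T g x. 0 \<le> \<beta> t) \<and>
        finite {t\<in>active_set T g x. \<beta> t \<noteq> 0} \<and>
        0 \<in> (\<Sum>i\<in>{1..p}. (*\<^sub>R) (\<alpha> i) ` subdifferential (\<lambda>y. ereal (f i y)) x)
            + (\<Sum>t\<in>{t\<in>active_set T g x. \<beta> t \<noteq> 0}. (*\<^sub>R) (\<beta> t) ` subdifferential (g t) x))"

end

theory Submission
  imports Defs
begin

text \<open>If \<open>0\<close> lay outside \<open>F\<^sub>* + closure G\<^sub>*\<close>, a hyperplane would strictly separate it from
  this set, because \<open>F\<^sub>*\<close>, the convex hull of finitely many compact subdifferentials, is compact,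
  and the sum of a compact and a closed convex set is closed and convex. As \<open>G\<^sub>*\<close> is a cone, the
  negative normal \<open>d\<close> of the hyperplane lies in \<open>F\<^sup>- \<inter> G\<^sup>0\<close>
  (\<open>separate_zero_from_compact_plus_closed_cone\<close>). The data qualification makes \<open>d\<close> tangent to the
  feasible set. But along feasible points \<open>x + t\<^sub>r w\<^sub>r\<close> with \<open>w\<^sub>r\<close> tending to \<open>d\<close> every objective
  eventually drops below its value at \<open>x\<close> (\<open>eventually_descent_along_tangent\<close>), which contradicts
  weak efficiency. This yields part (i).

  The descent argument avoids directional derivatives and the max formula. It rests on one compactness
  property (\<open>subgradient_cluster_point\<close>): subgradients of a finite convex function at points
  converging to \<open>x\<close> accumulate at a subgradient at \<open>x\<close>.

  For part (ii), closedness of \<open>G\<^sub>*\<close> removes the closure. What remains is to rewrite a point of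
  the convex hull, respectively of the convex cone, generated by a union of convex sets with a single
  multiplier for each set of the union (\<open>convex_cone_hull_UN_combination\<close>).\<close>

section \<open>Subdifferentials of convex functions\<close>

lemma mem_subdifferential_real:
  "\<xi> \<in> subdifferential (\<lambda>y. ereal (f y)) x \<longleftrightarrow> (\<forall>y. f x + \<xi> \<bullet> (y - x) \<le> f y)"
  by (simp add: subdifferential_def)

text \<open>Each point \<open>y\<close> imposes one affine inequality on the subgradient, so the subdifferential is an
  intersection of half-spaces, some of them possibly degenerate when \<open>h y\<close> is infinite.\<close>

lemma convex_subdifferential: "convex (subdifferential h x)"
proof (cases "\<bar>h x\<bar> = \<infinity>")
  case True
  then show ?thesis by (simp add: subdifferential_def)
next
  case False
  then obtain r where r: "h x = ereal r" by (cases "h x") auto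
  have half: "convex {\<xi>. ereal r + ereal (\<xi> \<bullet> (y - x)) \<le> h y}" for y
  proof (cases "h y")
    case (real s)
    then have "{\<xi>. ereal r + ereal (\<xi> \<bullet> (y - x)) \<le> h y} = {\<xi>. (y - x) \<bullet> \<xi> \<le> s - r}"
      by (auto simp: inner_commute)
    then show ?thesis by (simp add: convex_halfspace_le)
  qed auto
  have "subdifferential h x = (\<Inter>y. {\<xi>. ereal r + ereal (\<xi> \<bullet> (y - x)) \<le> h y})"
    using r by (auto simp: subdifferential_def)
  then show ?thesis by (simp only: convex_INT half)
qed

text \<open>A hyperplane separating \<open>(x, f x)\<close> from the strict epigraph cannot be vertical since \<open>f\<close> is finite
  everywhere; its slope is a subgradient.\<close>

lemma subdifferential_nonempty:
  fixes f :: "'a::euclidean_space \<Rightarrow> real"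
  assumes f: "convex_on UNIV f"
  shows "subdifferential (\<lambda>y. ereal (f y)) x \<noteq> {}"
proof -
  let ?E = "{(z, s). f z < s}"
  have "convex ?E"
  proof (rule convexI, clarsimp)
    fix a b :: 'a and s t u v :: real
    assume h: "f a < s" "f b < t" "0 \<le> u" "0 \<le> v" "u + v = 1"
    have "f (u *\<^sub>R a + v *\<^sub>R b) \<le> u * f a + v * f b"
      using f h by (auto simp: convex_on_def)
    also have "\<dots> < u * s + v * t"
    proof (cases "u = 0")
      case False
      with h show ?thesis by (intro add_less_le_mono mult_strict_left_mono mult_left_mono) auto
    qed (use h in auto)
    finally show "f (u *\<^sub>R a + v *\<^sub>R b) < u * s + v * t" .
  qed
  moreover have "(x, f x + 1) \<in> ?E" by simp
  moreover have "{(x, f x)} \<inter> ?E = {}" by auto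
  ultimately obtain w b where w: "w \<noteq> 0" "\<forall>q\<in>{(x, f x)}. w \<bullet> q \<le> b" "\<forall>q\<in>?E. b \<le> w \<bullet> q"
    using separating_hyperplane_sets[of "{(x, f x)}" ?E] by blast
  obtain a c where ac: "w = (a, c)" by (cases w)
  have strict: "a \<bullet> x + c * f x \<le> a \<bullet> z + c * s" if "f z < s" for z s
    using w that unfolding ac by fastforce
  have "0 \<le> c" using strict[of x "f x + 1"] by (simp add: algebra_simps)
  have "c \<noteq> 0"
  proof
    assume "c = 0"
    \<comment> \<open>A vertical hyperplane would bound a linear functional below on the whole space.\<close>
    then have "a \<bullet> x \<le> a \<bullet> (x - a)" using strict[of "x - a" "f (x - a) + 1"] by simp
    then have "a = 0" using inner_ge_zero[of a] by (simp add: inner_diff_right)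
    then show False using w(1) ac \<open>c = 0\<close> by (simp add: zero_prod_def)
  qed
  with \<open>0 \<le> c\<close> have c: "0 < c" by simp
  have "f x + (- (1 / c) *\<^sub>R a) \<bullet> (z - x) \<le> f z" for z
  proof (rule field_le_epsilon)
    fix e :: real
    assume "0 < e"
    then have "a \<bullet> x + c * f x \<le> a \<bullet> z + c * (f z + e)" using strict by simp
    with c show "f x + (- (1 / c) *\<^sub>R a) \<bullet> (z - x) \<le> f z + e"
      by (simp add: field_simps inner_diff_right)
  qed
  then have "- (1 / c) *\<^sub>R a \<in> subdifferential (\<lambda>y. ereal (f y)) x"
    unfolding mem_subdifferential_real by blast
  then show ?thesis by blast
qed

text \<open>The subgradients are bounded because \<open>f\<close> is bounded near the limit point, and the subgradient
  inequality passes to the limit because \<open>f\<close> is continuous. The base points may vary; constant ones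
  give compactness of a single subdifferential.\<close>

lemma subgradient_cluster_point:
  fixes f :: "'a::euclidean_space \<Rightarrow> real"
  assumes f: "convex_on UNIV f"
    and y: "y \<longlonglongrightarrow> x"
    and sub: "\<And>r :: nat. \<xi> r \<in> subdifferential (\<lambda>y. ereal (f y)) (y r)"
  obtains \<eta> s where "\<eta> \<in> subdifferential (\<lambda>y. ereal (f y)) x"
    and "strict_mono s" and "(\<xi> \<circ> s) \<longlonglongrightarrow> \<eta>"
proof -
  have cont: "continuous_on UNIV f" using f by (rule convex_on_continuous[OF open_UNIV])
  have ineq: "f (y r) + \<xi> r \<bullet> (z - y r) \<le> f z" for r z
    using sub[of r] by (simp add: mem_subdifferential_real)
  have "bounded (range y)" using y by (rule convergent_imp_bounded)
  then obtain R where R: "\<And>r. norm (y r) \<le> R" by (auto simp: bounded_iff)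
  have "bounded (f ` cball 0 (R + 1))"
    by (intro compact_imp_bounded compact_continuous_image continuous_on_subset[OF cont]) auto
  then obtain M where M: "\<And>z. norm z \<le> R + 1 \<Longrightarrow> \<bar>f z\<bar> \<le> M"
    by (force simp: bounded_iff)
  have bound: "norm (\<xi> r) \<le> 2 * M" for r
  proof -
    \<comment> \<open>Testing the subgradient inequality one unit away in its own direction.\<close>
    let ?z = "y r + sgn (\<xi> r)"
    have "norm ?z \<le> R + 1"
      using norm_triangle_ineq[of "y r" "sgn (\<xi> r)"] R[of r] by (simp add: norm_sgn split: if_splits)
    moreover have "norm (y r) \<le> R + 1" using R[of r] by simp
    moreover have "f (y r) + norm (\<xi> r) \<le> f ?z"
      using ineq[of r ?z] by (cases "\<xi> r = 0") (auto simp: sgn_div_norm norm_eq_sqrt_inner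
        real_sqrt_mult_self real_div_sqrt divide_inverse_commute[symmetric])
    ultimately show ?thesis using M[of ?z] M[of "y r"] by linarith
  qed
  then have "\<forall>r. \<xi> r \<in> cball 0 (2 * M)" by simp
  then obtain \<eta> s where s: "strict_mono s" "(\<xi> \<circ> s) \<longlonglongrightarrow> \<eta>"
    using compact_cball[of "0::'a" "2 * M"] unfolding compact_def by metis
  have ys: "(\<lambda>r. y (s r)) \<longlonglongrightarrow> x"
    using LIMSEQ_subseq_LIMSEQ[OF y s(1)] by (simp add: o_def)
  have fy: "(\<lambda>r. f (y (s r))) \<longlonglongrightarrow> f x"
    using continuous_on_tendsto_compose[OF cont ys] by simp
  have "f x + \<eta> \<bullet> (z - x) \<le> f z" for z
  proof (rule LIMSEQ_le_const2)
    show "(\<lambda>r. f (y (s r)) + \<xi> (s r) \<bullet> (z - y (s r))) \<longlonglongrightarrow> f x + \<eta> \<bullet> (z - x)"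
      using s(2) by (intro tendsto_intros fy ys) (simp add: o_def)
  qed (use ineq in blast)
  then show ?thesis by (intro that[OF _ s]) (simp add: mem_subdifferential_real)
qed

lemma compact_subdifferential:
  fixes f :: "'a::euclidean_space \<Rightarrow> real"
  assumes "convex_on UNIV f"
  shows "compact (subdifferential (\<lambda>y. ereal (f y)) x)"
  unfolding compact_def
proof (intro allI impI)
  fix \<xi> :: "nat \<Rightarrow> 'a"
  assume "\<forall>r. \<xi> r \<in> subdifferential (\<lambda>y. ereal (f y)) x"
  then obtain \<eta> s where "\<eta> \<in> subdifferential (\<lambda>y. ereal (f y)) x" "strict_mono s"
    "(\<xi> \<circ> s) \<longlonglongrightarrow> \<eta>"
    using subgradient_cluster_point[OF assms tendsto_const, of \<xi> x] by blast
  then show "\<exists>\<eta>\<in>subdifferential (\<lambda>y. ereal (f y)) x. \<exists>s. strict_mono s \<and> (\<xi> \<circ> s) \<longlonglongrightarrow> \<eta>"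
    by blast
qed

text \<open>Otherwise \<open>f x \<le> f y\<^sub>r\<close> at infinitely many of the points \<open>y\<^sub>r = x + t\<^sub>r w\<^sub>r\<close>. A subgradient \<open>\<xi>\<^sub>r\<close>
  at such a point, tested at \<open>x\<close>, satisfies \<open>0 \<le> \<xi>\<^sub>r \<bullet> w\<^sub>r\<close>, and a cluster point of these subgradients
  is a subgradient at \<open>x\<close> whose inner product with \<open>d\<close> is nonnegative.\<close>

lemma eventually_descent_along_tangent:
  fixes f :: "'a::euclidean_space \<Rightarrow> real"
  assumes f: "convex_on UNIV f"
    and d: "d \<in> strict_polar_cone (subdifferential (\<lambda>y. ereal (f y)) x)"
    and t: "\<And>r. 0 < t r" "t \<longlonglongrightarrow> 0" and w: "w \<longlonglongrightarrow> d"
  shows "\<forall>\<^sub>F r :: nat in sequentially. f (x + t r *\<^sub>R w r) < f x"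
proof (rule ccontr)
  assume "\<not> ?thesis"
  then have "\<exists>\<^sub>F r in sequentially. f x \<le> f (x + t r *\<^sub>R w r)"
    by (simp add: frequently_def not_le)
  then have "infinite {r. f x \<le> f (x + t r *\<^sub>R w r)}"
    by (simp add: INFM_iff_infinite[symmetric] cofinite_eq_sequentially)
  then obtain k :: "nat \<Rightarrow> nat" where k: "strict_mono k" "\<And>r. f x \<le> f (x + t (k r) *\<^sub>R w (k r))"
    using infinite_enumerate by blast
  define y where "y r = x + t (k r) *\<^sub>R w (k r)" for r
  have tk: "(\<lambda>r. t (k r)) \<longlonglongrightarrow> 0" and wk: "(\<lambda>r. w (k r)) \<longlonglongrightarrow> d"
    using LIMSEQ_subseq_LIMSEQ[OF t(2) k(1)] LIMSEQ_subseq_LIMSEQ[OF w k(1)] by (auto simp: o_def)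
  have y: "y \<longlonglongrightarrow> x"
    unfolding y_def using tendsto_add[OF tendsto_const tendsto_scaleR[OF tk wk], of x] by simp
  have "\<forall>r. \<exists>v. v \<in> subdifferential (\<lambda>y. ereal (f y)) (y r)"
    using subdifferential_nonempty[OF f] by blast
  then obtain \<xi> where \<xi>: "\<And>r. \<xi> r \<in> subdifferential (\<lambda>y. ereal (f y)) (y r)"
    unfolding choice_iff by blast
  have pos: "0 \<le> \<xi> r \<bullet> w (k r)" for r
  proof -
    have "f (y r) + \<xi> r \<bullet> (x - y r) \<le> f x" using \<xi> by (simp add: mem_subdifferential_real)
    with k(2)[of r] have "0 \<le> t (k r) * (\<xi> r \<bullet> w (k r))" by (simp add: y_def)
    with t(1)[of "k r"] show ?thesis by (simp add: zero_le_mult_iff)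
  qed
  obtain \<eta> s where \<eta>: "\<eta> \<in> subdifferential (\<lambda>y. ereal (f y)) x"
    and s: "strict_mono s" "(\<xi> \<circ> s) \<longlonglongrightarrow> \<eta>"
    using subgradient_cluster_point[OF f y \<xi>] .
  have "(\<lambda>r. \<xi> (s r) \<bullet> w (k (s r))) \<longlonglongrightarrow> \<eta> \<bullet> d"
    using s(2) LIMSEQ_subseq_LIMSEQ[OF wk s(1)] by (intro tendsto_inner) (simp_all add: o_def)
  then have "0 \<le> \<eta> \<bullet> d" by (rule LIMSEQ_le_const) (use pos in blast)
  with d \<eta> show False by (force simp: strict_polar_cone_def)
qed

section \<open>Cones and hulls\<close>

text \<open>A conic combination may use several points of the same \<open>C t\<close>. By convexity their weighted average
  lies in \<open>C t\<close>, so they merge into one point carrying the total weight. Hence the combinations with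
  a single multiplier for each index already form a convex cone.\<close>

lemma convex_cone_hull_UN_combination:
  fixes C :: "'t \<Rightarrow> 'a::real_vector set"
  assumes conv: "\<And>t. t \<in> I \<Longrightarrow> convex (C t)"
    and y: "y \<in> convex_cone hull (\<Union>t\<in>I. C t)"
  obtains \<beta> :: "'t \<Rightarrow> real" where "\<And>t. 0 \<le> \<beta> t" and "finite {t\<in>I. \<beta> t \<noteq> 0}"
    and "y \<in> (\<Sum>t\<in>{t\<in>I. \<beta> t \<noteq> 0}. (*\<^sub>R) (\<beta> t) ` C t)"
proof -
  define rep where "rep x \<beta> z \<longleftrightarrow> (\<forall>t. 0 \<le> \<beta> t) \<and> finite {t. \<beta> t \<noteq> 0} \<and>
      (\<forall>t. \<beta> t \<noteq> 0 \<longrightarrow> t \<in> I \<and> z t \<in> C t) \<and> x = (\<Sum>t | \<beta> t \<noteq> 0. \<beta> t *\<^sub>R z t)"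
    for x and \<beta> :: "'t \<Rightarrow> real" and z :: "'t \<Rightarrow> 'a"
  define K where "K = {x. \<exists>\<beta> z. rep x \<beta> z}"
  have zero: "0 \<in> K"
    unfolding K_def mem_Collect_eq by (intro exI[of _ "\<lambda>_. 0"]) (simp add: rep_def)
  have add: "x + x' \<in> K" if K: "x \<in> K" "x' \<in> K" for x x'
  proof -
    obtain \<beta> z \<beta>' z' where r: "rep x \<beta> z" "rep x' \<beta>' z'" using K by (auto simp: K_def)
    define \<gamma> where "\<gamma> t = \<beta> t + \<beta>' t" for t
    \<comment> \<open>The weighted average of the two points used for \<open>t\<close>. A point with weight zero may lie outside
      \<open>C t\<close> and is replaced by the other one.\<close>
    define u where "u t = (\<beta> t / \<gamma> t) *\<^sub>R (if \<beta> t = 0 then z' t else z t)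
        + (\<beta>' t / \<gamma> t) *\<^sub>R (if \<beta>' t = 0 then z t else z' t)" for t
    have nonneg: "0 \<le> \<beta> t" "0 \<le> \<beta>' t" for t using r by (auto simp: rep_def)
    have supp: "{t. \<gamma> t \<noteq> 0} = {t. \<beta> t \<noteq> 0} \<union> {t. \<beta>' t \<noteq> 0}"
      using nonneg by (auto simp: \<gamma>_def add_nonneg_eq_0_iff)
    have fin: "finite {t. \<gamma> t \<noteq> 0}" using r by (simp add: supp rep_def)
    have "t \<in> I \<and> u t \<in> C t" if "\<gamma> t \<noteq> 0" for t
    proof
      have pos: "0 < \<gamma> t" using nonneg[of t] that by (simp add: \<gamma>_def)
      show I: "t \<in> I" using that r supp by (auto simp: rep_def)
      show "u t \<in> C t"
        unfolding u_def
        by (rule convexD[OF conv[OF I]])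
           (use r pos nonneg[of t] that in
             \<open>auto simp: rep_def \<gamma>_def add_divide_distrib[symmetric]\<close>)
    qed
    moreover have "x + x' = (\<Sum>t | \<gamma> t \<noteq> 0. \<gamma> t *\<^sub>R u t)"
    proof -
      have "x = (\<Sum>t | \<gamma> t \<noteq> 0. \<beta> t *\<^sub>R z t)" "x' = (\<Sum>t | \<gamma> t \<noteq> 0. \<beta>' t *\<^sub>R z' t)"
        using r fin by (auto simp: rep_def supp intro!: sum.mono_neutral_left)
      then show ?thesis
        by (auto simp: sum.distrib[symmetric] u_def scaleR_add_right intro!: sum.cong)
    qed
    ultimately have "rep (x + x') \<gamma> u" using fin nonneg by (simp add: rep_def \<gamma>_def)
    then show ?thesis by (auto simp: K_def)
  qed
  have scale: "c *\<^sub>R x \<in> K" if K: "x \<in> K" "0 \<le> c" for x c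
  proof (cases "c = 0")
    case False
    obtain \<beta> z where "rep x \<beta> z" using K by (auto simp: K_def)
    then have "rep (c *\<^sub>R x) (\<lambda>t. c * \<beta> t) z"
      using False K by (simp add: rep_def scaleR_sum_right)
    then show ?thesis by (auto simp: K_def)
  qed (simp add: zero)
  have "convex_cone K" using zero add scale by (auto simp: convex_cone_iff)
  moreover have "(\<Union>t\<in>I. C t) \<subseteq> K"
  proof clarify
    fix t x assume "t \<in> I" "x \<in> C t"
    then have "rep x (\<lambda>s. if s = t then 1 else 0) (\<lambda>_. x)" by (simp add: rep_def)
    then show "x \<in> K" by (auto simp: K_def)
  qed
  ultimately have "y \<in> K" using y hull_minimal[of "\<Union>t\<in>I. C t" K convex_cone] by blast
  then obtain \<beta> z where r: "rep y \<beta> z" by (auto simp: K_def)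
  then have "{t\<in>I. \<beta> t \<noteq> 0} = {t. \<beta> t \<noteq> 0}" by (auto simp: rep_def)
  with r show ?thesis
    by (intro that[of \<beta>]) (auto simp: rep_def set_sum_alt)
qed

text \<open>The functional is bounded below by a positive number on the whole sum. The origin of the cone
  makes it positive on \<open>A\<close>; the unbounded rays of the cone make it nonnegative on \<open>B\<close>.\<close>

lemma separate_zero_from_compact_plus_closed_cone:
  fixes A :: "'a::euclidean_space set"
  assumes A: "convex A" "compact A" "A \<noteq> {}"
    and zero: "0 \<notin> A + closure (convex_cone hull B)"
  obtains d where "d \<in> strict_polar_cone A" and "d \<in> polar_cone B"
proof -
  let ?K = "convex_cone hull B"
  have "closed (A + closure ?K)"
  proof -
    have "A + closure ?K = (\<Union>x\<in>A. \<Union>y\<in>closure ?K. {x + y})" by (auto simp: set_plus_def)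
    then show ?thesis using compact_closed_sums[OF A(2) closed_closure] by simp
  qed
  moreover have "convex (A + closure ?K)"
    using A(1) by (intro convex_set_plus convex_closure convex_convex_cone_hull)
  ultimately obtain a b where b: "0 < b" and sep: "\<And>x. x \<in> A + closure ?K \<Longrightarrow> b < a \<bullet> x"
    using separating_hyperplane_closed_0 zero by meson
  have sepK: "b < a \<bullet> x + a \<bullet> y" if "x \<in> A" "y \<in> ?K" for x y
  proof -
    have "x + y \<in> A + closure ?K" using that closure_subset by blast
    then show ?thesis using sep by (simp add: inner_add_right[symmetric])
  qed
  have "x \<bullet> - a < 0" if "x \<in> A" for x
    using sepK[OF that convex_cone_hull_contains_0] b by (simp add: inner_commute)
  moreover have "y \<bullet> - a \<le> 0" if "y \<in> B" for y
  proof (rule ccontr)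
    assume "\<not> ?thesis"
    then have neg: "a \<bullet> y < 0" by (simp add: inner_commute)
    obtain x where x: "x \<in> A" using A(3) by blast
    \<comment> \<open>Far out on the ray through \<open>y\<close> the functional would drop to zero.\<close>
    define s where "s = (a \<bullet> x) / - (a \<bullet> y)"
    have "0 < a \<bullet> x" using sepK[OF x convex_cone_hull_contains_0] b by simp
    then have "0 \<le> s" using neg by (simp add: s_def divide_nonneg_neg)
    then have "s *\<^sub>R y \<in> ?K" using that by (intro convex_cone_hull_mul hull_inc)
    from sepK[OF x this] b neg show False by (simp add: s_def)
  qed
  ultimately show ?thesis
    by (intro that[of "- a"]) (auto simp: strict_polar_cone_def polar_cone_def)
qed

section \<open>Optimality conditions\<close>

lemma weak_efficient_no_descent_direction:
  fixes f :: "nat \<Rightarrow> 'a::euclidean_space \<Rightarrow> real"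
  assumes f: "\<And>i. i \<in> {1..p} \<Longrightarrow> convex_on UNIV (f i)"
    and eff: "weak_efficient p f T g x"
  shows "strict_polar_cone (F_subgrads p f x) \<inter> contingent_cone (feasible_set T g) x = {}"
proof (rule ccontr)
  assume "\<not> ?thesis"
  then obtain d where d: "d \<in> strict_polar_cone (F_subgrads p f x)"
    and "d \<in> contingent_cone (feasible_set T g) x" by blast
  then obtain t w where t: "\<And>r. 0 < t r" "t \<longlonglongrightarrow> 0" and w: "w \<longlonglongrightarrow> d"
    and S: "\<And>r :: nat. x + t r *\<^sub>R w r \<in> feasible_set T g" by (auto simp: contingent_cone_def)
  have "\<forall>\<^sub>F r in sequentially. f i (x + t r *\<^sub>R w r) < f i x" if i: "i \<in> {1..p}" for i
    by (rule eventually_descent_along_tangent[OF f[OF i] _ t w])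
       (use d i in \<open>auto simp: strict_polar_cone_def F_subgrads_def\<close>)
  then have "\<forall>\<^sub>F r in sequentially. \<forall>i\<in>{1..p}. f i (x + t r *\<^sub>R w r) < f i x"
    by (intro eventually_ball_finite) auto
  then obtain r where "\<forall>i\<in>{1..p}. f i (x + t r *\<^sub>R w r) < f i x"
    using eventually_happens'[OF sequentially_bot] by blast
  with eff S show False by (auto simp: weak_efficient_def)
qed

text \<open>The existence of subgradients matters here: an objective with multiplier \<open>0\<close> still contributes a
  summand \<open>0 *\<^sub>R \<partial>f\<^sub>i(x)\<close> to the Minkowski sum, which would make the sum empty if \<open>\<partial>f\<^sub>i(x)\<close> were
  empty. For the constraints this is avoided by summing over the support of \<open>\<beta>\<close> only.\<close>

lemma weak_KKT_if_zero_in_F_star_plus_G_star: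
  fixes f :: "nat \<Rightarrow> 'a::euclidean_space \<Rightarrow> real"
  assumes f: "\<And>i. i \<in> {1..p} \<Longrightarrow> convex_on UNIV (f i)"
    and zero: "0 \<in> F_star p f x + G_star T g x"
  shows "weak_KKT p f T g x"
proof -
  let ?D = "\<lambda>i. subdifferential (\<lambda>y. ereal (f i y)) x"
  obtain u v where uv: "u \<in> F_star p f x" "v \<in> G_star T g x" "0 = u + v"
    using zero by (metis set_plus_elim)
  have "\<forall>i\<in>{1..p}. convex (?D i) \<and> ?D i \<noteq> {}"
    using f by (simp add: convex_subdifferential subdifferential_nonempty)
  then obtain \<alpha> s where \<alpha>: "\<forall>i\<in>{1..p}. 0 \<le> \<alpha> i" "sum \<alpha> {1..p} = 1" "\<forall>i\<in>{1..p}. s i \<in> ?D i"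
    and u: "u = (\<Sum>i\<in>{1..p}. \<alpha> i *\<^sub>R s i)"
    using uv(1) convex_hull_finite_union[of "{1..p}" ?D]
    unfolding F_star_def F_subgrads_def by auto
  obtain \<beta> where \<beta>: "\<And>t. 0 \<le> \<beta> t" "finite {t\<in>active_set T g x. \<beta> t \<noteq> 0}"
    "v \<in> (\<Sum>t\<in>{t\<in>active_set T g x. \<beta> t \<noteq> 0}. (*\<^sub>R) (\<beta> t) ` subdifferential (g t) x)"
    using convex_cone_hull_UN_combination[OF convex_subdifferential
        uv(2)[unfolded G_star_def G_subgrads_def]] by blast
  have "u \<in> (\<Sum>i\<in>{1..p}. (*\<^sub>R) (\<alpha> i) ` ?D i)"
    using \<alpha>(3) by (auto simp: u set_sum_alt)
  from set_plus_intro[OF this \<beta>(3)] \<alpha> \<beta>(1,2) uv(3) show ?thesis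
    unfolding weak_KKT_def by (intro exI[of _ \<alpha>] exI[of _ \<beta>]) simp
qed

theorem theorem2:
  fixes p :: nat
    and f :: "nat \<Rightarrow> real ^ 'n \<Rightarrow> real"
    and T :: "'t set"
    and g :: "'t \<Rightarrow> real ^ 'n \<Rightarrow> ereal"
    and xhat :: "real ^ 'n"
  assumes "p \<ge> 2"
    and "\<And>i. i \<in> {1..p} \<Longrightarrow> convex_on UNIV (f i)"
    and "infinite T"
    and "\<And>t. t \<in> T \<Longrightarrow> lower_semicontinuous (g t)"
    and "\<And>t. t \<in> T \<Longrightarrow> proper_ereal (g t)"
    and "\<And>t. t \<in> T \<Longrightarrow> convex_ereal (g t)"
    and "feasible_set T g \<noteq> {}"
    and "weak_efficient p f T g xhat"
  shows "(WADQ p f T g xhat \<longrightarrow> 0 \<in> F_star p f xhat + closure (G_star T g xhat)) \<and>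
         (WADQ p f T g xhat \<and> CCCQ T g xhat \<longrightarrow> weak_KKT p f T g xhat)"
proof -
  let ?F = "F_star p f xhat" and ?G = "G_star T g xhat"
  note f = assms(2)
  have part1: "0 \<in> ?F + closure ?G" if wadq: "WADQ p f T g xhat"
  proof (rule ccontr)
    assume neg: "0 \<notin> ?F + closure ?G"
    have "compact (F_subgrads p f xhat)"
      unfolding F_subgrads_def using f by (intro compact_UN compact_subdifferential) auto
    then have "compact ?F" unfolding F_star_def by (rule compact_convex_hull)
    moreover have "?F \<noteq> {}"
      using subdifferential_nonempty[OF f[of 1], of xhat] assms(1)
      by (force simp: F_star_def F_subgrads_def)
    ultimately obtain d where d: "d \<in> strict_polar_cone ?F" "d \<in> polar_cone (G_subgrads T g xhat)"
      using separate_zero_from_compact_plus_closed_cone[of ?F "G_subgrads T g xhat"] neg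
      by (auto simp: F_star_def G_star_def)
    have "d \<in> strict_polar_cone (F_subgrads p f xhat)"
      using d(1) hull_subset by (fastforce simp: strict_polar_cone_def F_star_def)
    with d(2) wadq weak_efficient_no_descent_direction[OF f assms(8)] show False
      by (auto simp: WADQ_def)
  qed
  moreover have "weak_KKT p f T g xhat" if "WADQ p f T g xhat" "CCCQ T g xhat"
    using part1[OF that(1)] that(2) f
    by (auto simp: CCCQ_def intro: weak_KKT_if_zero_in_F_star_plus_G_star)
  ultimately show ?thesis by blast
qed

end
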